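(* Consider a Markov decision process with finite state space $\mathcal{X}$, finite action space $\mathcal{U}$, reward (cost) vector $\mathcal{R}\in\mathbb{R}^{|\mathcal{X}|}$, discount factor $\alpha\in\,]0,1[$, and optimal transition probability matrix $\mathcal{P}^*\in\mathbb{R}^{|\mathcal{X}|\times|\mathcal{X}|}$, the Markov chain with transition matrix $\mathcal{P}^*$ being regular. Let $\mathcal{Q}\in\mathbb{R}^{|\mathcal{X}|\times|\mathcal{X}|}$ be a stochastic matrix (associated with an exploratory policy), let $\mathcal{A}=\alpha I$, and define the perturbed transition probability matrix $$\bar{\mathcal{P}}=(I-\mathcal{A})\mathcal{Q}+\mathcal{A}\mathcal{P}^*.$$ Let $\bar\epsilon$ be the stationary probability distribution of $\bar{\mathcal{P}}$, let $\bar\Theta$ be the diagonal matrix with the entries of $\bar\epsilon$ on its diagonal, and let $\Phi\in\mathbb{R}^{|\mathcal{X}|\times\psi}$ be a feature matrix of full column rank $\psi$. Define $$\bar{\mathcal{Z}}=\Phi^\top\bar\Theta(I-\alpha\mathcal{P}^* )\Phi,\qquad \bar d=\Phi^\top\bar\Theta\mathcal{R}.$$ Then, for any initial vector $\bar r_0\in\mathbb{R}^\psi$, the sequence $(\bar r_k)_{k\ge 0}$ in $\mathbb{R}^\psi$ given by the recursive iteration $$\bar r_{k+1}=\bar r_k-(\Phi^\top\bar\Theta\Phi)^{-1}\left(\bar{\mathcal{Z}}\bar r_k-\bar d\right)$$ converges to the solution $\bar r$ of the projected Bellman equation $$\Phi\bar r=\bar\Pi\left(\mathcal{R}+\alpha\mathcal{P}^*\Phi\bar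 r\right),\qquad \bar\Pi=\Phi(\Phi^\top\bar\Theta\Phi)^{-1}\Phi^\top\bar\Theta.$$
   Context: The Markov decision process has controlled transition probabilities $\mathcal{P}_{xx'}(u)$ for $x,x'\in\mathcal{X}$, $u\in\mathcal{U}$, and instantaneous costs $\mathcal{R}(x)$ not depending on the action. The optimal cost $J^*\in\mathbb{R}^{|\mathcal{X}|}$ is the unique solution of $J^*(x)=\min_{u\in\mathcal{U}}\big[\mathcal{R}(x)+\alpha\sum_{x'}\mathcal{P}_{xx'}(u)J^*(x')\big]$ for all $x \in \mathcal{X}$. If $\mu^*:\mathcal{X}\to\mathcal{U}$ is a stationary policy attaining these minima, the optimal transition probability matrix is $\mathcal{P}^*_{xx'}=\mathcal{P}_{xx'}(\mu^*(x))$. A stochastic matrix is a square matrix with nonnegative entries and row sums equal to 1. A finite Markov chain is regular if some power of its transition matrix has all entries strictly positive. A stationary distribution of a stochastic matrix $\mathcal{M}$ is a probability vector $\epsilon$ with $\epsilon^\top \mathcal{M}=\epsilon^\top$. *)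

theory Defs
  imports "HOL-Analysis.Analysis"
begin

definition stochastic_matrix :: "real^'n^'n \<Rightarrow> bool" where
  "stochastic_matrix M \<longleftrightarrow> (\<forall>i j. 0 \<le> M $ i $ j) \<and> (\<forall>i. (\<Sum>j\<in>UNIV. M $ i $ j) = 1)"

text \<open>The overloaded \<open>*\<close> and \<open>^\<close> on \<open>vec\<close> act componentwise, so powers of a
  matrix are defined separately.\<close>

primrec matrix_power :: "real^'n^'n \<Rightarrow> nat \<Rightarrow> real^'n^'n" where
  "matrix_power M 0 = mat 1"
| "matrix_power M (Suc n) = M ** matrix_power M n"

definition regular_chain :: "real^'n^'n \<Rightarrow> bool" where
  "regular_chain M \<longleftrightarrow> (\<exists>n>0. \<forall>i j. 0 < matrix_power M n $ i $ j)"

definition probability_vector :: "real^'n \<Rightarrow> bool" where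
  "probability_vector p \<longleftrightarrow> (\<forall>i. 0 \<le> p $ i) \<and> (\<Sum>i\<in>UNIV. p $ i) = 1"

definition stationary_distribution :: "real^'n^'n \<Rightarrow> real^'n \<Rightarrow> bool" where
  "stationary_distribution M p \<longleftrightarrow> probability_vector p \<and> p v* M = p"

definition diag_matrix :: "real^'n \<Rightarrow> real^'n^'n" where
  "diag_matrix p = (\<chi> i j. if i = j then p $ i else 0)"

text \<open>In a Markov decision process, \<open>P u $ x $ x'\<close> is the probability of moving from state
  \<open>x\<close> to state \<open>x'\<close> under action \<open>u\<close>.\<close>

definition controlled_transitions :: "('u::finite \<Rightarrow> real^'x^'x) \<Rightarrow> bool" where
  "controlled_transitions P \<longleftrightarrow> (\<forall>u. stochastic_matrix (P u))"

definition bellman_value ::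
    "('u::finite \<Rightarrow> real^'x^'x) \<Rightarrow> real^'x \<Rightarrow> real \<Rightarrow> real^'x \<Rightarrow> 'x \<Rightarrow> 'u \<Rightarrow> real" where
  "bellman_value P R \<alpha> J x u = R $ x + \<alpha> * (\<Sum>x'\<in>UNIV. P u $ x $ x' * J $ x')"

text \<open>For \<open>0 < \<alpha> < 1\<close> and stochastic \<open>P u\<close> the Bellman operator is a sup-norm contraction,
  so the description below denotes its unique fixed point.\<close>

definition optimal_cost ::
    "('u::finite \<Rightarrow> real^'x^'x) \<Rightarrow> real^'x \<Rightarrow> real \<Rightarrow> real^'x" where
  "optimal_cost P R \<alpha> = (THE J. \<forall>x. J $ x = Min (range (bellman_value P R \<alpha> J x)))"

definition optimal_policy ::
    "('u::finite \<Rightarrow> real^'x^'x) \<Rightarrow> real^'x \<Rightarrow> real \<Rightarrow> ('x \<Rightarrow> 'u) \<Rightarrow> bool" where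
  "optimal_policy P R \<alpha> \<mu> \<longleftrightarrow>
     (\<forall>x. bellman_value P R \<alpha> (optimal_cost P R \<alpha>) x (\<mu> x)
          = Min (range (bellman_value P R \<alpha> (optimal_cost P R \<alpha>) x)))"

definition policy_transitions ::
    "('u::finite \<Rightarrow> real^'x^'x) \<Rightarrow> ('x \<Rightarrow> 'u) \<Rightarrow> real^'x^'x" where
  "policy_transitions P \<mu> = (\<chi> x x'. P (\<mu> x) $ x $ x')"

definition perturbed_transitions ::
    "real^'x^'x \<Rightarrow> real^'x^'x \<Rightarrow> real^'x^'x \<Rightarrow> real^'x^'x" where
  "perturbed_transitions A Q P = (mat 1 - A) ** Q + A ** P"

end

theory Submission
  imports Defs
begin

text \<open>Put \<open>\<parallel>v\<parallel>\<^sup>2 = (\<Sum>i. p i * v i ^ 2)\<close> for the stationary distribution \<open>p\<close> of the perturbed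
  chain. Stationarity gives \<open>p = (1 - \<alpha>) p Q + \<alpha> p P\<^sup>*\<close>, hence \<open>\<alpha> p P\<^sup>* \<le> p\<close> entrywise. Iterating
  this inequality, regularity of \<open>P\<^sup>*\<close> forces \<open>p > 0\<close>; combining it with Jensen's inequality gives
  \<open>\<parallel>\<alpha> P\<^sup>* v\<parallel>\<^sup>2 \<le> \<alpha> \<parallel>v\<parallel>\<^sup>2\<close>. The projection onto the range of \<open>\<Phi>\<close> does not increase this norm, so the
  iteration, which in the variable \<open>\<Phi> r\<close> is the projected Bellman operator, is a contraction.\<close>

section \<open>The weighted squared norm and its inner product\<close>

definition weighted_sqnorm :: "real^'n \<Rightarrow> real^'n \<Rightarrow> real" where
  "weighted_sqnorm p v = (\<Sum>i\<in>UNIV. p $ i * (v $ i)\<^sup>2)"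

lemma weighted_sqnorm_scaleR:
  "weighted_sqnorm p (c *\<^sub>R v) = c\<^sup>2 * weighted_sqnorm p v"
  by (simp add: weighted_sqnorm_def power_mult_distrib sum_distrib_left mult_ac)

lemma weighted_sqnorm_component:
  assumes "\<And>i. 0 \<le> p $ i"
  shows "p $ i * (v $ i)\<^sup>2 \<le> weighted_sqnorm p v"
  unfolding weighted_sqnorm_def
  by (rule member_le_sum) (auto simp: assms)

lemma weighted_sqnorm_le_zero_imp:
  assumes "\<And>i. 0 < p $ i" and "weighted_sqnorm p v \<le> 0"
  shows "v = 0"
proof -
  have "v $ i = 0" for i
  proof -
    have "p $ i * (v $ i)\<^sup>2 \<le> 0"
      using weighted_sqnorm_component[of p i v] assms by (meson less_imp_le order_trans)
    then show ?thesis
      using assms(1)[of i] by (simp add: mult_le_0_iff)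
  qed
  then show ?thesis
    by (simp add: vec_eq_iff)
qed

lemma diag_matrix_vector_mult: "(diag_matrix p *v v) $ i = p $ i * v $ i"
proof -
  have "(diag_matrix p *v v) $ i = (\<Sum>j\<in>UNIV. if i = j then p $ i * v $ j else 0)"
    unfolding diag_matrix_def matrix_vector_mult_def vec_lambda_beta
    by (rule sum.cong) auto
  then show ?thesis
    by simp
qed

lemma inner_diag_matrix: "v \<bullet> (diag_matrix p *v w) = (\<Sum>i\<in>UNIV. p $ i * (v $ i * w $ i))"
  by (simp add: inner_vec_def diag_matrix_vector_mult mult_ac)

lemma inner_diag_matrix_self: "v \<bullet> (diag_matrix p *v v) = weighted_sqnorm p v"
  by (simp add: inner_diag_matrix weighted_sqnorm_def power2_eq_square)

text \<open>Young's inequality \<open>2ab \<le> a\<^sup>2 + b\<^sup>2\<close> in each coordinate,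
  weighted by \<open>p\<close>. It serves in place of Cauchy-Schwarz, so that all later estimates
  stay with squared norms.\<close>

lemma inner_diag_matrix_le:
  assumes "\<And>i. 0 \<le> p $ i"
  shows "2 * (v \<bullet> (diag_matrix p *v w)) \<le> weighted_sqnorm p v + weighted_sqnorm p w"
proof -
  have "2 * (p $ i * (v $ i * w $ i)) \<le> p $ i * (v $ i)\<^sup>2 + p $ i * (w $ i)\<^sup>2" for i
    using mult_left_mono[OF sum_squares_bound[of "v $ i" "w $ i"] assms[of i]]
    by (simp add: algebra_simps)
  then show ?thesis
    unfolding inner_diag_matrix weighted_sqnorm_def sum_distrib_left sum.distrib[symmetric]
    by (intro sum_mono) auto
qed

section \<open>Subinvariance and positivity of the stationary distribution\<close>

lemma stochastic_policy_transitions: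
  "controlled_transitions P \<Longrightarrow> stochastic_matrix (policy_transitions P \<mu>)"
  by (simp add: controlled_transitions_def stochastic_matrix_def policy_transitions_def)

lemma vector_matrix_mult_nth:
  fixes p :: "real^'n" and M :: "real^'m^'n"
  shows "(p v* M) $ j = (\<Sum>i\<in>UNIV. p $ i * M $ i $ j)"
  by (simp add: vector_matrix_mult_def mult.commute)

lemma vector_matrix_mult_mono:
  fixes M :: "real^'m^'n"
  assumes "\<And>i j. 0 \<le> M $ i $ j" and "\<And>i. p $ i \<le> q $ i"
  shows "(p v* M) $ j \<le> (q v* M) $ j"
  unfolding vector_matrix_mult_nth
  by (intro sum_mono mult_right_mono assms)

lemma stationary_perturbed_ge:
  assumes "stationary_distribution (perturbed_transitions (\<alpha> *\<^sub>R mat 1) Q M) p"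
    and "stochastic_matrix Q" and "\<alpha> \<le> 1"
  shows "\<alpha> * (p v* M) $ j \<le> p $ j"
proof -
  have "p $ j = (p v* perturbed_transitions (\<alpha> *\<^sub>R mat 1) Q M) $ j"
    using assms(1) by (simp add: stationary_distribution_def)
  also have "\<dots> = (((1 - \<alpha>) *\<^sub>R p) v* Q + (\<alpha> *\<^sub>R p) v* M) $ j"
    by (simp add: perturbed_transitions_def vector_matrix_mult_add_rdistrib
        vector_matrix_mul_assoc[symmetric] vector_matrix_mult_diff_rdistrib vector_scaleR_matrix_ac
        scaleR_left_diff_distrib)
  also have "\<dots> = (1 - \<alpha>) * (p v* Q) $ j + \<alpha> * (p v* M) $ j"
    by (simp add: vector_matrix_mult_nth sum_distrib_left sum.distrib sum_subtractf algebra_simps)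
  also have "\<dots> \<ge> \<alpha> * (p v* M) $ j"
    using assms by (auto simp: vector_matrix_mult_nth stationary_distribution_def
        probability_vector_def stochastic_matrix_def intro!: mult_nonneg_nonneg sum_nonneg)
  finally show ?thesis .
qed

text \<open>Since \<open>p v* M^(n+1)\<close> is \<open>(p v* M) v* M^n\<close>, one factor \<alpha>
  can be spent on replacing \<open>p v* M\<close> by \<open>p\<close>; the nonnegative matrix
  \<open>M^n\<close> preserves the inequality.\<close>

lemma subinvariant_power:
  assumes "\<And>j. \<alpha> * (p v* M) $ j \<le> p $ j" and "0 \<le> \<alpha>" and "\<And>i j. 0 \<le> M $ i $ j"
  shows "\<alpha> ^ n * (p v* matrix_power M n) $ j \<le> p $ j"
proof (induction n arbitrary: j)
  case 0
  then show ?case by simp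
next
  case (Suc n)
  have nonneg: "0 \<le> matrix_power M n $ i $ j" for i j
    by (induction n arbitrary: i j)
      (auto simp: mat_def matrix_matrix_mult_def intro!: sum_nonneg mult_nonneg_nonneg assms(3))
  have "\<alpha> ^ Suc n * (p v* matrix_power M (Suc n)) $ j
      = \<alpha> ^ n * ((\<alpha> *\<^sub>R (p v* M)) v* matrix_power M n) $ j"
    by (simp add: vector_matrix_mul_assoc[symmetric] vector_matrix_mult_nth[of "_ *\<^sub>R _"]
        vector_matrix_mult_nth[of "p v* M"] sum_distrib_left mult_ac)
  also have "\<dots> \<le> \<alpha> ^ n * (p v* matrix_power M n) $ j"
    by (intro mult_left_mono vector_matrix_mult_mono nonneg) (auto simp: assms)
  also have "\<dots> \<le> p $ j"
    by (rule Suc.IH)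
  finally show ?case .
qed

text \<open>A probability vector charges some state \<open>k\<close>, and an entrywise positive
  power of \<open>M\<close> carries mass from \<open>k\<close> to every state
  \<open>j\<close>.\<close>

lemma subinvariant_regular_pos:
  assumes "\<And>j. \<alpha> * (p v* M) $ j \<le> p $ j" and "0 < \<alpha>" and "\<And>i j. 0 \<le> M $ i $ j"
    and "regular_chain M" and "probability_vector p"
  shows "0 < p $ j"
proof -
  obtain n where n: "\<And>i j. 0 < matrix_power M n $ i $ j"
    using assms(4) by (auto simp: regular_chain_def)
  have p: "\<And>i. 0 \<le> p $ i" "(\<Sum>i\<in>UNIV. p $ i) = 1"
    using assms(5) by (auto simp: probability_vector_def)
  obtain k where k: "p $ k \<noteq> 0"
    using p(2) by (metis sum.neutral zero_neq_one)
  have "0 < p $ k * matrix_power M n $ k $ j"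
    using k p(1)[of k] n[of k j] by simp
  also have "\<dots> \<le> (p v* matrix_power M n) $ j"
    unfolding vector_matrix_mult_nth
    by (rule member_le_sum) (auto intro!: mult_nonneg_nonneg p(1) less_imp_le[OF n])
  finally have "0 < \<alpha> ^ n * (p v* matrix_power M n) $ j"
    using assms(2) by simp
  also have "\<dots> \<le> p $ j"
    by (rule subinvariant_power) (use assms in auto)
  finally show ?thesis .
qed

section \<open>Contraction by the discounted transition matrix\<close>

lemma stochastic_jensen:
  assumes "stochastic_matrix M"
  shows "((M *v v) $ i)\<^sup>2 \<le> (\<Sum>j\<in>UNIV. M $ i $ j * (v $ j)\<^sup>2)"
proof -
  let ?m = "(M *v v) $ i"
  have m: "?m = (\<Sum>j\<in>UNIV. M $ i $ j * v $ j)"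
    by (simp add: matrix_vector_mult_def)
  \<comment> \<open>This is the variance of \<open>v\<close> under the probability distribution in
    row \<open>i\<close>, whose mean is \<open>?m\<close>.\<close>
  have "0 \<le> (\<Sum>j\<in>UNIV. M $ i $ j * (v $ j - ?m)\<^sup>2)"
    using assms by (auto simp: stochastic_matrix_def intro!: sum_nonneg)
  also have "\<dots> = (\<Sum>j\<in>UNIV. M $ i $ j * (v $ j)\<^sup>2 - 2 * ?m * (M $ i $ j * v $ j) + ?m\<^sup>2 * M $ i $ j)"
    by (intro sum.cong refl) (simp add: power2_eq_square algebra_simps)
  also have "\<dots> = (\<Sum>j\<in>UNIV. M $ i $ j * (v $ j)\<^sup>2) - 2 * ?m * ?m + ?m\<^sup>2"
    using assms
    by (simp add: sum.distrib sum_subtractf sum_distrib_left[symmetric] m[symmetric]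
        stochastic_matrix_def)
  finally show ?thesis
    by (simp add: power2_eq_square)
qed

text \<open>Jensen's inequality in each row, followed by an exchange of the two sums, moves the
  matrix from the vector to the weights.\<close>

lemma weighted_sqnorm_stochastic:
  assumes "stochastic_matrix M" and "\<And>i. 0 \<le> p $ i"
  shows "weighted_sqnorm p (M *v v) \<le> weighted_sqnorm (p v* M) v"
proof -
  have "weighted_sqnorm p (M *v v) \<le> (\<Sum>i\<in>UNIV. p $ i * (\<Sum>j\<in>UNIV. M $ i $ j * (v $ j)\<^sup>2))"
    unfolding weighted_sqnorm_def
    by (intro sum_mono mult_left_mono stochastic_jensen assms)
  also have "\<dots> = (\<Sum>i\<in>UNIV. \<Sum>j\<in>UNIV. p $ i * M $ i $ j * (v $ j)\<^sup>2)"
    by (simp add: sum_distrib_left mult_ac)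
  also have "\<dots> = (\<Sum>j\<in>UNIV. \<Sum>i\<in>UNIV. p $ i * M $ i $ j * (v $ j)\<^sup>2)"
    by (rule sum.swap)
  also have "\<dots> = weighted_sqnorm (p v* M) v"
    by (simp add: weighted_sqnorm_def vector_matrix_mult_nth sum_distrib_right)
  finally show ?thesis .
qed

text \<open>Scaling contributes \<open>\<alpha>\<^sup>2\<close>. One factor is absorbed by
  subinvariance, turning the weights \<open>p v* M\<close> back into \<open>p\<close>; the other
  remains as the contraction factor.\<close>

lemma weighted_sqnorm_discounted:
  assumes "stochastic_matrix M" and "\<And>i. 0 \<le> p $ i"
    and "\<And>j. \<alpha> * (p v* M) $ j \<le> p $ j" and "0 \<le> \<alpha>"
  shows "weighted_sqnorm p (\<alpha> *\<^sub>R (M *v v)) \<le> \<alpha> * weighted_sqnorm p v"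
proof -
  have "weighted_sqnorm p (\<alpha> *\<^sub>R (M *v v)) \<le> \<alpha>\<^sup>2 * weighted_sqnorm (p v* M) v"
    unfolding weighted_sqnorm_scaleR
    by (intro mult_left_mono weighted_sqnorm_stochastic assms) auto
  also have "\<dots> = \<alpha> * (\<Sum>j\<in>UNIV. (\<alpha> * (p v* M) $ j) * (v $ j)\<^sup>2)"
    by (simp add: weighted_sqnorm_def sum_distrib_left power2_eq_square mult_ac)
  also have "\<dots> \<le> \<alpha> * weighted_sqnorm p v"
    unfolding weighted_sqnorm_def
    by (intro mult_left_mono sum_mono mult_right_mono assms) auto
  finally show ?thesis .
qed

section \<open>Gram matrix and weighted projection\<close>

lemma inner_transpose_matrix:
  fixes A :: "real^'k^'x"
  shows "x \<bullet> (transpose A *v z) = (A *v x) \<bullet> z"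
  by (metis dot_lmul_matrix inner_commute transpose_matrix_vector)

text \<open>The quadratic form of the Gram matrix at \<open>x\<close> is the weighted squared norm
  of \<open>\<Phi> *v x\<close>; positive weights and injectivity of \<open>\<Phi>\<close> make the
  kernel trivial.\<close>

lemma invertible_weighted_gram:
  fixes \<Phi> :: "real^'k^'x"
  assumes "\<And>i. 0 < p $ i" and "rank \<Phi> = CARD('k)"
  shows "invertible (transpose \<Phi> ** diag_matrix p ** \<Phi>)"
proof -
  have "x = 0" if "(transpose \<Phi> ** diag_matrix p ** \<Phi>) *v x = 0" for x
  proof -
    have "weighted_sqnorm p (\<Phi> *v x) = x \<bullet> (transpose \<Phi> *v (diag_matrix p *v (\<Phi> *v x)))"
      by (simp only: inner_transpose_matrix inner_diag_matrix_self)
    also have "\<dots> = 0"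
      using that by (simp add: matrix_vector_mul_assoc matrix_mul_assoc del: transpose_matrix_vector)
    finally have "\<Phi> *v x = 0"
      using weighted_sqnorm_le_zero_imp assms(1) by (metis order_refl)
    then show ?thesis
      using assms(2) full_rank_injective by (metis injD matrix_vector_mult_0_right)
  qed
  then show ?thesis
    by (simp add: invertible_left_inverse matrix_left_invertible_ker)
qed

lemma matrix_inv_mult_vector:
  fixes G :: "real^'k^'k"
  assumes "invertible G"
  shows "matrix_inv G *v (G *v x) = x" and "G *v (matrix_inv G *v x) = x"
proof -
  have "G ** matrix_inv G = mat 1 \<and> matrix_inv G ** G = mat 1"
    unfolding matrix_inv_def using assms unfolding invertible_def by (rule someI_ex)
  then show "matrix_inv G *v (G *v x) = x" and "G *v (matrix_inv G *v x) = x"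
    by (simp_all add: matrix_vector_mul_assoc)
qed

lemma weighted_projection_le:
  fixes \<Phi> :: "real^'k^'x" and w :: "real^'x"
  assumes "\<And>i. 0 < p $ i" and "rank \<Phi> = CARD('k)"
  defines "G \<equiv> transpose \<Phi> ** diag_matrix p ** \<Phi>"
  shows "weighted_sqnorm p (\<Phi> *v (matrix_inv G *v ((transpose \<Phi> ** diag_matrix p) *v w)))
      \<le> weighted_sqnorm p w"
proof -
  let ?D = "diag_matrix p"
  define y where "y = matrix_inv G *v ((transpose \<Phi> ** ?D) *v w)"
  have "invertible G"
    unfolding G_def by (rule invertible_weighted_gram) (use assms in auto)
  \<comment> \<open>The normal equations. Pairing them with \<open>y\<close> gives
    \<open>\<parallel>\<Phi> y\<parallel>\<^sup>2 = \<langle>\<Phi> y, w\<rangle>\<close> in the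
    weighted inner product, and Young's inequality then bounds twice the left side by
    \<open>\<parallel>\<Phi> y\<parallel>\<^sup>2 + \<parallel>w\<parallel>\<^sup>2\<close>.\<close>
  then have y: "G *v y = transpose \<Phi> *v (?D *v w)"
    unfolding y_def by (simp only: matrix_inv_mult_vector matrix_vector_mul_assoc[of "transpose \<Phi>"])
  have "weighted_sqnorm p (\<Phi> *v y) = y \<bullet> (G *v y)"
    by (simp only: G_def inner_diag_matrix_self inner_transpose_matrix
        matrix_vector_mul_assoc[symmetric])
  also have "\<dots> = (\<Phi> *v y) \<bullet> (?D *v w)"
    by (simp only: y inner_transpose_matrix)
  finally show ?thesis
    using inner_diag_matrix_le[of p "\<Phi> *v y" w] assms(1)
    by (simp add: y_def[symmetric] less_imp_le)
qed

section \<open>Convergence of the affine iteration\<close>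

text \<open>Contraction is measured after applying \<open>\<Phi>\<close>. The fixed point comes from
  linear algebra: a contraction has no nonzero fixed vector, so the square matrix
  \<open>mat 1 - L\<close> is invertible.\<close>

lemma affine_iteration_converges:
  fixes L :: "real^'k^'k" and \<Phi> :: "real^'k^'x"
  assumes p: "\<And>i. 0 < p $ i" and rank: "rank \<Phi> = CARD('k)"
    and contr: "\<And>u. weighted_sqnorm p (\<Phi> *v (L *v u)) \<le> \<alpha> * weighted_sqnorm p (\<Phi> *v u)"
    and \<alpha>: "0 \<le> \<alpha>" "\<alpha> < 1"
    and step: "\<And>k. r (Suc k) = L *v r k + b"
  shows "\<exists>!s. s = L *v s + b" and "s = L *v s + b \<Longrightarrow> r \<longlonglongrightarrow> s"
proof -
  let ?N = "\<lambda>u. weighted_sqnorm p (\<Phi> *v u)"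
  have inj: "inj ((*v) \<Phi>)"
    using rank full_rank_injective by blast
  have fix0: "u = 0" if "u = L *v u" for u
  proof -
    have "?N u \<le> \<alpha> * ?N u"
      using contr[of u] that by simp
    then have "(1 - \<alpha>) * ?N u \<le> 0"
      by (simp add: algebra_simps)
    then have "?N u \<le> 0"
      using \<alpha> by (simp add: mult_le_0_iff)
    then have "\<Phi> *v u = 0"
      using weighted_sqnorm_le_zero_imp p by blast
    then show ?thesis
      using inj by (metis injD matrix_vector_mult_0_right)
  qed
  have "invertible (mat 1 - L)"
    unfolding invertible_left_inverse matrix_left_invertible_ker
    by (auto simp: matrix_vector_mult_diff_rdistrib intro: fix0)
  note inv = matrix_inv_mult_vector[OF this]
  show "\<exists>!s. s = L *v s + b"
  proof (rule ex_ex1I)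
    show "\<exists>s. s = L *v s + b"
      using inv(2)[of b] by (intro exI[of _ "matrix_inv (mat 1 - L) *v b"])
        (simp add: matrix_vector_mult_diff_rdistrib algebra_simps)
  next
    fix s t assume "s = L *v s + b" "t = L *v t + b"
    then have "s - t = L *v (s - t)"
      by (metis add_diff_cancel_right matrix_vector_mult_diff_distrib)
    then show "s = t"
      using fix0[of "s - t"] by simp
  qed
  assume s: "s = L *v s + b"
  \<comment> \<open>Subtracting the fixed-point equation cancels \<open>b\<close>, so the errors
    follow the homogeneous iteration and decay geometrically.\<close>
  have "r (Suc k) - s = L *v (r k - s)" for k
    using s step[of k] by (metis add_diff_cancel_right matrix_vector_mult_diff_distrib)
  then have "?N (r (Suc k) - s) \<le> \<alpha> * ?N (r k - s)" for k
    using contr by simp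
  then have bound: "?N (r k - s) \<le> \<alpha> ^ k * ?N (r 0 - s)" for k
  proof (induction k)
    case (Suc k)
    then show ?case
      using mult_left_mono[OF Suc.IH \<alpha>(1)] by (force simp: mult.assoc intro: order_trans)
  qed simp
  have geom: "(\<lambda>k. \<alpha> ^ k * ?N (r 0 - s)) \<longlonglongrightarrow> 0"
    using \<alpha> by (intro tendsto_mult_left_zero LIMSEQ_realpow_zero) auto
  have "(\<lambda>k. (\<Phi> *v (r k - s)) $ i) \<longlonglongrightarrow> 0" for i
  proof -
    have "(\<lambda>k. p $ i * ((\<Phi> *v (r k - s)) $ i)\<^sup>2) \<longlonglongrightarrow> 0"
    proof (rule tendsto_sandwich[OF _ _ tendsto_const geom])
      show "\<forall>\<^sub>F k in sequentially. p $ i * ((\<Phi> *v (r k - s)) $ i)\<^sup>2 \<le> \<alpha> ^ k * ?N (r 0 - s)"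
        using weighted_sqnorm_component[of p i] p bound
        by (intro always_eventually allI) (meson less_imp_le order_trans)
    qed (use p in \<open>auto intro!: always_eventually mult_nonneg_nonneg simp: less_imp_le\<close>)
    \<comment> \<open>Positivity of \<open>p $ i\<close> allows the weight to be divided out, giving
      convergence in every coordinate.\<close>
    from tendsto_mult_left[OF this, of "inverse (p $ i)"]
    have "(\<lambda>k. ((\<Phi> *v (r k - s)) $ i)\<^sup>2) \<longlonglongrightarrow> 0"
      using p[of i] by (simp add: field_simps)
    then show ?thesis
      using tendsto_real_sqrt tendsto_rabs_zero_iff by fastforce
  qed
  then have lim: "(\<lambda>k. \<Phi> *v (r k - s)) \<longlonglongrightarrow> 0"
    by (intro vec_tendstoI) simp
  let ?G = "transpose \<Phi> ** diag_matrix p ** \<Phi>"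
  \<comment> \<open>\<open>?H\<close> is a left inverse of \<open>\<Phi>\<close>; its continuity
    transfers convergence from \<open>\<Phi> *v (r k - s)\<close> to \<open>r k - s\<close>.\<close>
  let ?H = "matrix_inv ?G ** (transpose \<Phi> ** diag_matrix p)"
  have "?H *v (\<Phi> *v u) = u" for u
    using matrix_inv_mult_vector(1)[OF invertible_weighted_gram[of p \<Phi>], of u] p rank
    by (simp add: matrix_vector_mul_assoc matrix_mul_assoc)
  moreover have "(\<lambda>k. ?H *v (\<Phi> *v (r k - s))) \<longlonglongrightarrow> ?H *v 0"
    by (rule bounded_linear.tendsto[OF matrix_vector_mul_bounded_linear lim])
  ultimately show "r \<longlonglongrightarrow> s"
    by (simp add: LIM_zero_iff)
qed

section \<open>The projected Bellman equation in feature coordinates\<close>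

theorem theorem3:
  fixes P :: "'u::finite \<Rightarrow> real^'x^'x"
    and R :: "real^'x"
    and \<alpha> :: real
    and \<mu> :: "'x \<Rightarrow> 'u"
    and Pstar Q A Pbar Thetabar Pibar :: "real^'x^'x"
    and \<epsilon>bar :: "real^'x"
    and \<Phi> :: "real^'k^'x"
    and Zbar :: "real^'k^'k"
    and dbar r0 :: "real^'k"
    and r :: "nat \<Rightarrow> real^'k"
  assumes "controlled_transitions P"
    and "0 < \<alpha>" and "\<alpha> < 1"
    and "optimal_policy P R \<alpha> \<mu>"
    and "Pstar = policy_transitions P \<mu>"
    and "regular_chain Pstar"
    and "stochastic_matrix Q"
    and "A = \<alpha> *\<^sub>R mat 1"
    and "Pbar = perturbed_transitions A Q Pstar"
    and "stationary_distribution Pbar \<epsilon>bar"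
    and "Thetabar = diag_matrix \<epsilon>bar"
    and "rank \<Phi> = CARD('k)"
    and "Zbar = transpose \<Phi> ** Thetabar ** (mat 1 - \<alpha> *\<^sub>R Pstar) ** \<Phi>"
    and "dbar = (transpose \<Phi> ** Thetabar) *v R"
    and "Pibar = \<Phi> ** matrix_inv (transpose \<Phi> ** Thetabar ** \<Phi>) ** transpose \<Phi> ** Thetabar"
    and "r 0 = r0"
    and "\<And>k. r (Suc k) = r k - matrix_inv (transpose \<Phi> ** Thetabar ** \<Phi>) *v (Zbar *v r k - dbar)"
  shows "(\<exists>!rbar. \<Phi> *v rbar = Pibar *v (R + \<alpha> *\<^sub>R (Pstar *v (\<Phi> *v rbar)))) \<and>
         (\<forall>rbar. \<Phi> *v rbar = Pibar *v (R + \<alpha> *\<^sub>R (Pstar *v (\<Phi> *v rbar))) \<longrightarrow> r \<longlonglongrightarrow> rbar)"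
proof -
  define D where "D = diag_matrix \<epsilon>bar"
  define G where "G = transpose \<Phi> ** D ** \<Phi>"
  \<comment> \<open>\<open>L\<close> and \<open>b\<close> are the linear part and the constant term
    of the projected Bellman operator, in coordinates with respect to the columns of
    \<open>\<Phi>\<close>.\<close>
  define L where "L = matrix_inv G ** (transpose \<Phi> ** D) ** (\<alpha> *\<^sub>R Pstar) ** \<Phi>"
  define b where "b = matrix_inv G *v ((transpose \<Phi> ** D) *v R)"
  have stoch: "stochastic_matrix Pstar"
    using assms(1,5) stochastic_policy_transitions by blast
  then have nonneg: "0 \<le> Pstar $ i $ j" for i j
    by (simp add: stochastic_matrix_def)
  have prob: "probability_vector \<epsilon>bar"
    using assms(10) by (simp add: stationary_distribution_def)
  have sub: "\<alpha> * (\<epsilon>bar v* Pstar) $ j \<le> \<epsilon>bar $ j" for j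
    using stationary_perturbed_ge assms(3,7-10) by (metis less_imp_le)
  have pos: "0 < \<epsilon>bar $ j" for j
    by (rule subinvariant_regular_pos[OF sub assms(2) nonneg assms(6) prob])
  have inj: "inj ((*v) \<Phi>)"
    using assms(12) full_rank_injective by blast
  have inv: "invertible G"
    unfolding G_def D_def by (rule invertible_weighted_gram[OF pos assms(12)])
  have L: "L *v u = matrix_inv G *v ((transpose \<Phi> ** D) *v (\<alpha> *\<^sub>R (Pstar *v (\<Phi> *v u))))" for u
    by (simp add: L_def matrix_vector_mul_assoc[symmetric] scaleR_matrix_vector_assoc)
  have contr: "weighted_sqnorm \<epsilon>bar (\<Phi> *v (L *v u)) \<le> \<alpha> * weighted_sqnorm \<epsilon>bar (\<Phi> *v u)" for u
    unfolding L G_def D_def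
    by (rule order_trans[OF weighted_projection_le[OF pos assms(12)]
          weighted_sqnorm_discounted[OF stoch less_imp_le[OF pos] sub less_imp_le[OF assms(2)]]])
  have step: "r (Suc k) = L *v r k + b" for k
  proof -
    \<comment> \<open>The identity inside \<open>Zbar\<close> contributes \<open>G\<close>. After
      multiplication by \<open>matrix_inv G\<close> this term is \<open>r k\<close>, which cancels
      the leading \<open>r k\<close> of the recursion.\<close>
    have "Zbar *v r k = G *v r k - (transpose \<Phi> ** D) *v (\<alpha> *\<^sub>R (Pstar *v (\<Phi> *v r k)))"
      by (simp add: assms(11,13) G_def D_def matrix_vector_mul_assoc[symmetric]
          matrix_vector_mult_diff_distrib matrix_vector_mult_diff_rdistrib
          scaleR_matrix_vector_assoc)
    then have "r (Suc k) = r k - (matrix_inv G *v (G *v r k) - L *v r k - b)"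
      using assms(17)[of k]
      by (simp add: assms(11,14) G_def[symmetric] D_def[symmetric] L b_def
          matrix_vector_mult_diff_distrib)
    then show ?thesis
      by (simp add: matrix_inv_mult_vector[OF inv])
  qed
  have proj: "Pibar *v (R + \<alpha> *\<^sub>R (Pstar *v (\<Phi> *v s))) = \<Phi> *v (L *v s + b)" for s
    by (simp add: assms(11,15) G_def[symmetric] D_def[symmetric] L b_def
        matrix_vector_mul_assoc[symmetric] matrix_vector_right_distrib add.commute)
  \<comment> \<open>Both sides of the Bellman equation lie in the range of \<open>\<Phi>\<close>, so
    injectivity reduces it to the fixed-point equation for the coordinates.\<close>
  have "\<Phi> *v s = Pibar *v (R + \<alpha> *\<^sub>R (Pstar *v (\<Phi> *v s))) \<longleftrightarrow> s = L *v s + b" for s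
    unfolding proj using inj by (auto dest: injD)
  then show ?thesis
    using affine_iteration_converges[where p = \<epsilon>bar and \<Phi> = \<Phi> and L = L and r = r and b = b,
        OF pos assms(12) contr less_imp_le[OF assms(2)] assms(3) step]
    by simp
qed

end
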